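(* Let $\Gamma$ be an ellipse in the Euclidean plane and let $F_1$ be one of its foci. Let $P(t)$ be the position at time $t$ of a point which moves (twice differentiably in $t$) along $\Gamma$ (ellipse law), and suppose that the area swept out per unit time by the segment $\overline{F_1P}$ is a nonzero constant (area law). Then the acceleration vector $\overrightarrow{a}=\frac{d^2}{dt^2}\overrightarrow{F_1P}$ always points towards $F_1$, and its magnitude is inversely proportional to the square of the distance $\overline{PF_1}$; that is, there is a constant $C>0$, independent of $t$, such that for all $t$ $$\overrightarrow{a}(t)=-\frac{C}{r(t)^2}\,\frac{\overrightarrow{F_1P}(t)}{r(t)},\qquad r(t)=|\overrightarrow{F_1P}(t)|.$$
   Context: An ellipse with foci $F_1,F_2$ is the set of points $P$ of the plane with $\overline{PF_1}+\overline{PF_2}=2a$, where $\overline{F_1F_2}=2c$ and $0\le c<a$ (for $c=0$ the foci coincide and $\Gamma$ is a circle). The area swept out per unit time by $\overline{F_1P}$ is the (signed) quantity $\frac{dA}{dt}=\frac12\,\det\left(\overrightarrow{F_1P},\overrightarrow{v}\right)$ with $\overrightarrow{v}=\frac{d}{dt}\overrightarrow{F_1P}$; equivalently $2\frac{dA}{dt}=r^2\dot\theta$ in polar coordinates $(r,\theta)$ centered at $F_1$. *)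

theory Defs
  imports "HOL-Analysis.Analysis"
begin

definition ellipse_with_foci :: "real^2 \<Rightarrow> real^2 \<Rightarrow> (real^2) set \<Rightarrow> bool" where
  "ellipse_with_foci F1 F2 \<Gamma> \<longleftrightarrow>
     (\<exists>a c. 0 \<le> c \<and> c < a \<and> dist F1 F2 = 2 * c \<and>
            \<Gamma> = {X. dist X F1 + dist X F2 = 2 * a})"

text \<open>
  Signed area swept out per unit time by a segment from a fixed point, where \<open>u\<close> is the vector
  along the segment and \<open>w\<close> its time derivative. They are the rows of the matrix, so the
  determinant is \<open>u $ 1 * w $ 2 - u $ 2 * w $ 1\<close>.
\<close>
definition area_rate :: "real^2 \<Rightarrow> real^2 \<Rightarrow> real" where
  "area_rate u w = 1/2 * det (vector [u, w] :: real^2^2)"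

end

theory Submission
  imports Defs
begin

text \<open>
  Squaring \<open>dist P F2 = 2 * a - r\<close> shows that along the ellipse \<open>r = p + e \<bullet> u\<close> is affine in
  \<open>u = P - F1\<close>, with \<open>p = (a\<^sup>2 - c\<^sup>2) / a\<close> and \<open>e = (F2 - F1) / (2 * a)\<close>. The constant area rate
  makes the acceleration parallel to \<open>u\<close>, and its size is then found by differentiating
  \<open>u \<bullet> u = (p + e \<bullet> u)\<^sup>2\<close> twice: with \<open>h\<close> twice the area rate, \<open>C = h\<^sup>2 / p\<close>.
\<close>

lemma ellipse_focal_equation:
  fixes u d :: "'a::real_inner"
  assumes "0 \<le> c" "c < a" "norm d = 2 * c" "norm u + norm (u - d) = 2 * a"
  defines "p \<equiv> (a\<^sup>2 - c\<^sup>2) / a" and "e \<equiv> d /\<^sub>R (2 * a)"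
  shows "p > 0" "norm u = p + e \<bullet> u" "norm u > 0"
proof -
  have a: "a > 0" using assms by linarith
  have "c\<^sup>2 < a\<^sup>2" using assms by (intro power_strict_mono) auto
  then show p: "p > 0" using a by (simp add: p_def)
  have "norm (u - d) = 2 * a - norm u" using assms(4) by linarith
  then have "(norm (u - d))\<^sup>2 = (2 * a - norm u)\<^sup>2" by (rule arg_cong)
  moreover have "(norm (u - d))\<^sup>2 = (norm u)\<^sup>2 - 2 * (d \<bullet> u) + (2 * c)\<^sup>2"
    unfolding assms(3)[symmetric] power2_norm_eq_inner
    by (simp add: inner_diff inner_commute)
  ultimately have "4 * a * norm u = 4 * a\<^sup>2 - 4 * c\<^sup>2 + 2 * (d \<bullet> u)"
    by (simp add: power2_eq_square algebra_simps)
  then show r: "norm u = p + e \<bullet> u"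
    using a by (simp add: p_def e_def field_simps power2_eq_square)
  \<comment> \<open>At \<open>u = 0\<close> the affine equation would read
    \<open>0 = p\<close>.\<close>
  have "u \<noteq> 0" using r p by auto
  then show "norm u > 0" by simp
qed

text \<open>Allows an identity known only on \<open>T\<close> to be differentiated: by openness it
  holds near \<open>t\<close>, so both sides share one derivative there.\<close>

lemma has_real_derivative_unique_on_open:
  fixes f g :: "real \<Rightarrow> real"
  assumes "open T" "t \<in> T" "\<And>s. s \<in> T \<Longrightarrow> f s = g s"
    and "(f has_real_derivative x) (at t)" "(g has_real_derivative y) (at t)"
  shows "x = y"
  using assms has_field_derivative_transform_within_open DERIV_unique by metis

lemma has_vector_derivative_vec_nth:
  "(f has_vector_derivative y) F \<Longrightarrow> ((\<lambda>s. f s $ i) has_real_derivative y $ i) F"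
  using bounded_linear.has_vector_derivative[OF bounded_linear_vec_nth]
  by (simp add: has_real_derivative_iff_has_vector_derivative)

text \<open>The algebra at a single instant, with \<open>v\<close> and \<open>a\<close> as
  independent unknowns: \<open>r'\<close> and \<open>r''\<close> come from differentiating the
  second equation in \<open>r\<close>, and \<open>par\<close> from differentiating \<open>h\<close>.
  Scaling by the square of \<open>r\<close> lets the velocity be eliminated.\<close>

lemma central_acceleration_coordinates:
  fixes u1 u2 v1 v2 a1 a2 e1 e2 h p r :: real
  assumes "p > 0" "r > 0"
    and r: "r = p + (e1 * u1 + e2 * u2)" "r\<^sup>2 = u1\<^sup>2 + u2\<^sup>2"
    and r': "u1 * v1 + u2 * v2 = r * (e1 * v1 + e2 * v2)"
    and r'': "v1\<^sup>2 + v2\<^sup>2 + (u1 * a1 + u2 * a2) = (e1 * v1 + e2 * v2)\<^sup>2 + r * (e1 * a1 + e2 * a2)"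
    and h: "u1 * v2 - u2 * v1 = h" and par: "u1 * a2 = u2 * a1"
  shows "a1 = - (h\<^sup>2 / p / r ^ 3 * u1)" "a2 = - (h\<^sup>2 / p / r ^ 3 * u2)"
proof -
  \<comment> \<open>As the acceleration is parallel to \<open>u\<close>, this inner product
    determines it.\<close>
  define m where "m = u1 * a1 + u2 * a2"
  have a: "r\<^sup>2 * a1 = m * u1" "r\<^sup>2 * a2 = m * u2"
    unfolding r(2) m_def using par by algebra+
  have "r\<^sup>2 * (e1 * a1 + e2 * a2) = e1 * (r\<^sup>2 * a1) + e2 * (r\<^sup>2 * a2)"
    by algebra
  also have "\<dots> = m * (r - p)" unfolding a using r(1) by algebra
  finally have ea: "r\<^sup>2 * (e1 * a1 + e2 * a2) = m * (r - p)" .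
  \<comment> \<open>Lagrange's identity splits the speed into its radial and areal parts.\<close>
  have lagrange: "r\<^sup>2 * (v1\<^sup>2 + v2\<^sup>2) = (u1 * v1 + u2 * v2)\<^sup>2 + h\<^sup>2"
    unfolding r(2) h[symmetric] by algebra
  \<comment> \<open>This is \<open>r''\<close> times \<open>r\<^sup>2\<close>. By \<open>r'\<close>
    the square of \<open>r * (e1 * v1 + e2 * v2)\<close> is the radial part, which then cancels
    against the one in \<open>lagrange\<close>.\<close>
  have "r\<^sup>2 * (v1\<^sup>2 + v2\<^sup>2) + r\<^sup>2 * m = (u1 * v1 + u2 * v2)\<^sup>2 + r * (r\<^sup>2 * (e1 * a1 + e2 * a2))"
    unfolding r' using r'' unfolding m_def by algebra
  then have "h\<^sup>2 = - (r * m * p)"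
    unfolding lagrange ea by algebra
  then have m: "m = - (h\<^sup>2 / (p * r))"
    using \<open>p > 0\<close> \<open>r > 0\<close> by (simp add: field_simps)
  have "x = - (h\<^sup>2 / p / r ^ 3 * y)" if "r\<^sup>2 * x = m * y" for x y
  proof -
    have "x = m * y / r\<^sup>2" using that \<open>r > 0\<close> by (simp add: field_simps)
    then show ?thesis
      unfolding m by (simp add: power2_eq_square power3_eq_cube)
  qed
  with a show "a1 = - (h\<^sup>2 / p / r ^ 3 * u1)" "a2 = - (h\<^sup>2 / p / r ^ 3 * u2)" by blast+
qed

theorem mainTheorem1:
  fixes F1 F2 :: "real^2" and \<Gamma> :: "(real^2) set" and T :: "real set"
    and P v acc :: "real \<Rightarrow> real^2"
  assumes "ellipse_with_foci F1 F2 \<Gamma>"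
    and "open T" and "is_interval T"
    and "\<And>t. t \<in> T \<Longrightarrow> P t \<in> \<Gamma>"
    and "\<And>t. t \<in> T \<Longrightarrow> ((\<lambda>s. P s - F1) has_vector_derivative v t) (at t)"
    and "\<And>t. t \<in> T \<Longrightarrow> (v has_vector_derivative acc t) (at t)"
    and "\<exists>k. k \<noteq> 0 \<and> (\<forall>t\<in>T. area_rate (P t - F1) (v t) = k)"
  shows "\<exists>C>0. \<forall>t\<in>T.
           acc t = - ((C / (norm (P t - F1))\<^sup>2) *\<^sub>R ((1 / norm (P t - F1)) *\<^sub>R (P t - F1)))"
proof -
  obtain a c where ac: "0 \<le> c" "c < a" "dist F1 F2 = 2 * c"
    and \<Gamma>: "\<Gamma> = {X. dist X F1 + dist X F2 = 2 * a}"
    using assms(1) unfolding ellipse_with_foci_def by blast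
  obtain k where "k \<noteq> 0" and k: "\<And>t. t \<in> T \<Longrightarrow> area_rate (P t - F1) (v t) = k"
    using assms(7) by blast
  define u where "u t = P t - F1" for t
  define d where "d = F2 - F1"
  define p where "p = (a\<^sup>2 - c\<^sup>2) / a"
  define e where "e = d /\<^sub>R (2 * a)"
  define h where "h = 2 * k"
  have d: "norm d = 2 * c" using ac(3) by (simp add: d_def dist_norm norm_minus_commute)
  have sum: "norm (u t) + norm (u t - d) = 2 * a" if "t \<in> T" for t
    using assms(4)[OF that] unfolding \<Gamma> by (simp add: u_def d_def dist_norm)
  note focal = ellipse_focal_equation[OF ac(1,2) d sum, folded p_def e_def]
  have "c\<^sup>2 < a\<^sup>2" using ac by (intro power_strict_mono) auto
  then have p: "p > 0" using ac by (simp add: p_def)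
  have area: "u t $ 1 * v t $ 2 - u t $ 2 * v t $ 1 = h" if "t \<in> T" for t
    using k[OF that] by (simp add: area_rate_def det_2 vector_2 u_def h_def)
  have du: "((\<lambda>s. u s $ i) has_real_derivative v t $ i) (at t)"
    and dv: "((\<lambda>s. v s $ i) has_real_derivative acc t $ i) (at t)" if "t \<in> T" for t i
    using assms(5,6)[OF that] unfolding u_def[symmetric]
    by (auto intro: has_vector_derivative_vec_nth)
  note [derivative_intros] = du dv
  \<comment> \<open>Standing in for the norm, this affine expression keeps every identity to be
    differentiated polynomial in the coordinates.\<close>
  let ?r = "\<lambda>t. p + (e $ 1 * u t $ 1 + e $ 2 * u t $ 2)"
  have r: "norm (u t) = ?r t" "(?r t)\<^sup>2 = (u t $ 1)\<^sup>2 + (u t $ 2)\<^sup>2" if "t \<in> T" for t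
  proof -
    show r: "norm (u t) = ?r t" using focal(2)[OF that] by (simp add: inner_vec_def sum_2)
    show "(?r t)\<^sup>2 = (u t $ 1)\<^sup>2 + (u t $ 2)\<^sup>2"
      unfolding r[symmetric] power2_norm_eq_inner
      by (simp add: inner_vec_def sum_2 power2_eq_square)
  qed
  have r': "u t $ 1 * v t $ 1 + u t $ 2 * v t $ 2 = ?r t * (e $ 1 * v t $ 1 + e $ 2 * v t $ 2)"
    if "t \<in> T" for t
  proof -
    have "2 * (?r t * (e $ 1 * v t $ 1 + e $ 2 * v t $ 2)) =
        2 * (u t $ 1 * v t $ 1 + u t $ 2 * v t $ 2)"
      by (rule has_real_derivative_unique_on_open[OF assms(2) that r(2)])
        (use that in \<open>auto intro!: derivative_eq_intros simp: algebra_simps\<close>)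
    then show ?thesis by simp
  qed
  have r'': "(v t $ 1)\<^sup>2 + (v t $ 2)\<^sup>2 + (u t $ 1 * acc t $ 1 + u t $ 2 * acc t $ 2) =
      (e $ 1 * v t $ 1 + e $ 2 * v t $ 2)\<^sup>2 + ?r t * (e $ 1 * acc t $ 1 + e $ 2 * acc t $ 2)"
    if "t \<in> T" for t
    by (rule has_real_derivative_unique_on_open[OF assms(2) that r'])
      (use that in \<open>auto intro!: derivative_eq_intros simp: algebra_simps power2_eq_square\<close>)
  have par: "u t $ 1 * acc t $ 2 = u t $ 2 * acc t $ 1" if "t \<in> T" for t
  proof -
    \<comment> \<open>On differentiating the constant \<open>h\<close>, the products of velocity
      components cancel.\<close>
    have "u t $ 1 * acc t $ 2 - u t $ 2 * acc t $ 1 = 0"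
      by (rule has_real_derivative_unique_on_open[OF assms(2) that area])
        (use that in \<open>auto intro!: derivative_eq_intros simp: algebra_simps\<close>)
    then show ?thesis by simp
  qed
  have "acc t = - ((h\<^sup>2 / p / (norm (u t))\<^sup>2) *\<^sub>R ((1 / norm (u t)) *\<^sub>R u t))"
    if "t \<in> T" for t
  proof -
    have "?r t > 0" using focal(3)[OF that] r(1)[OF that] by simp
    \<comment> \<open>With \<open>?r t\<close> taken as \<open>r\<close>, the affine equation is
      \<open>refl\<close>; folding restores the norm.\<close>
    note acc = central_acceleration_coordinates[OF p this refl r(2)[OF that] r'[OF that]
        r''[OF that] area[OF that] par[OF that], folded r(1)[OF that]]
    have "acc t $ i = - (h\<^sup>2 / p / norm (u t) ^ 3 * u t $ i)" for i
      using acc exhaust_2[of i] by auto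
    then show ?thesis by (simp add: vec_eq_iff power2_eq_square power3_eq_cube)
  qed
  moreover have "h\<^sup>2 / p > 0" using \<open>k \<noteq> 0\<close> p by (simp add: h_def)
  ultimately show ?thesis unfolding u_def by blast
qed

end
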